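(* Consider the nonlinear system $$\dot x=f(x)+Bu+Ed,\qquad y=h(x),\qquad e=y-r,$$ with $x\in\mathbb R^n$, $u\in\mathbb R^m$, constant disturbance $d\in\mathbb R^q$, constant reference $r\in\mathbb R^p$, $y,e\in\mathbb R^p$. Assume $f(x)=AZ(x)$ and $h(x)=CZ(x)$ for some $A\in\mathbb R^{n\times s}$, $C\in\mathbb R^{p\times s}$, with $Z:\mathbb R^n\to\mathbb R^s$ continuously differentiable of the form $Z(x)=\begin{bmatrix} x \\ Q(x) \end{bmatrix}$, $Q:\mathbb R^n\to\mathbb R^{s-n}$ containing only nonlinear functions, and let $\mathcal Z(x,\xi)=\begin{bmatrix} x \\ \xi \\ Q(x) \end{bmatrix}$, $\xi\in\mathbb R^p$. Let $U_0,\mathcal Z_0,\mathcal Z_1$ be the data matrices defined in the context. Let $R_Q\in\mathbb R^{n\times\tau}$ be a matrix such that $\frac{\partial Q}{\partial x}(x)^\top\frac{\partial Q}{\partial x}(x)\preceq R_QR_Q^\top$ for any $x\in\mathbb R^n$, and set $\mathcal R_Q:=\begin{bmatrix} R_Q \\ 0_{p\times\tau} \end{bmatrix}$. Suppose that the following semidefinite program in the decision variables $\mathcal P\in\mathbb S^{(n+p)\times(n+p)}$, $\mathcal Y_1\in\mathbb R^{T\times(n+p)}$, $\mathcal G_2\in\mathbb R^{T\times(s-n)}$, $\alpha\in\mathbb R_{>0}$ is feasible: $$\mathcal P\succ0,\qquad \mathcal Z_0\mathcal Y_1=\begin{bmatrix} \mathcal P \\ 0_{(s-n)\times(n+p)}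 \end{bmatrix},$$ $$\begin{bmatrix} \mathcal Z_1\mathcal Y_1+(\mathcal Z_1\mathcal Y_1)^\top+\alpha I_{n+p} & \star & \star \\ \mathcal G_2^\top\mathcal Z_1^\top & -I_{s-n} & \star \\ \mathcal R_Q^\top\mathcal P & 0 & -I_\tau \end{bmatrix}\preceq0,$$ $$\mathcal Z_0\mathcal G_2=\begin{bmatrix} 0_{(n+p)\times(s-n)} \\ I_{s-n} \end{bmatrix},\qquad \mathbb 1_{1\times T}\begin{bmatrix} \mathcal Y_1 & \mathcal G_2 \end{bmatrix}=0_{1\times(s+p)}.$$ Then the control law $u=\mathcal K\mathcal Z(x,\xi)$ with $\mathcal K=U_0\begin{bmatrix} \mathcal Y_1\mathcal P^{-1} & \mathcal G_2 \end{bmatrix}$ is such that the solutions $(x(t),\xi(t))$ of the closed-loop dynamics $$\dot x=f(x)+B\mathcal K\mathcal Z(x,\xi)+Ed,\qquad \dot\xi=e=h(x)-r$$ are bounded for all $t\ge0$ and satisfy $e(t)\to0$ as $t\to+\infty$.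
   Context: $\mathbb S^{k\times k}$ is the set of real symmetric $k\times k$ matrices; $\succ,\succeq,\prec,\preceq$ refer to (semi)definiteness; $\star$ denotes entries determined by symmetry; $\mathbb 1_{1\times T}$ is the $1\times T$ matrix of all ones. Throughout, $d$ and $r$ are constant, and $A,B,C,d$ are unknown to the designer. Partition $A=[\overline A\ \ \hat A]$, $C=[\overline C\ \ \hat C]$ with $\overline A\in\mathbb R^{n\times n}$, $\overline C\in\mathbb R^{p\times n}$. The system extended with $\dot\xi=e$ reads $\begin{bmatrix} \dot x \\ \dot\xi \end{bmatrix}=\mathcal A\mathcal Z(x,\xi)+\mathcal Bu+\mathcal Ed-\mathcal Ir$, where $$\mathcal A=\begin{bmatrix} \overline A & 0_{n\times p} & \hat A \\ \overline C & 0_{p\times p} & \hat C \end{bmatrix},\quad \mathcal B=\begin{bmatrix} B \\ 0_{p\times m} \end{bmatrix},\quad \mathcal E=\begin{bmatrix} E \\ 0_{p\times q} \end{bmatrix},\quad \mathcal I=\begin{bmatrix} 0_{n\times p} \\ I_p \end{bmatrix}.$$ Data: for an integer $T>0$ and distinct sampling times $t_0<\dots<t_{T-1}$, samples of $x,u,y,\dot x,\xi$ along a trajectory of the extended system (with the constant disturbance $d$) are collected in $U_0=[u(t_0)\ \cdots\ u(t_{T-1})]$, $$\mathcal Z_1=\begin{bmatrix} \dot x(t_0) & \cdots & \dot x(t_{T-1}) \\ y(t_0) & \cdots & y(t_{T-1}) \end{bmatrix},\qquad \mathcal Z_0=\begin{bmatrix} x(t_0) & \cdots & x(t_{T-1})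 \\ \xi(t_0) & \cdots & \xi(t_{T-1}) \\ Q(x(t_0)) & \cdots & Q(x(t_{T-1})) \end{bmatrix}.$$ They satisfy $\mathcal Z_1=\mathcal A\mathcal Z_0+\mathcal BU_0+\mathcal ED_0$ with $D_0=d\,\mathbb 1_{1\times T}$. *)

theory Defs
  imports "HOL-Analysis.Analysis"
begin

text \<open>Concatenation along the row index. Since a matrix \<open>'a ^ 'c ^ 'r\<close> is a vector of rows,
  \<open>vstack\<close> serves both for vectors and for matrices with the same column type.\<close>

definition vstack :: "'a ^ 'm \<Rightarrow> 'a ^ 'n \<Rightarrow> 'a ^ ('m + 'n)" where
  "vstack x y = (\<chi> i. case i of Inl a \<Rightarrow> x $ a | Inr b \<Rightarrow> y $ b)"

definition hstack :: "'a ^ 'm ^ 'r \<Rightarrow> 'a ^ 'n ^ 'r \<Rightarrow> 'a ^ ('m + 'n) ^ 'r" where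
  "hstack M N = (\<chi> i. vstack (M $ i) (N $ i))"

text \<open>The matrix with columns \<open>w j\<close>.\<close>

definition from_columns :: "('t \<Rightarrow> 'a ^ 'n) \<Rightarrow> 'a ^ 't ^ 'n" where
  "from_columns w = (\<chi> i j. w j $ i)"

text \<open>Symmetric block matrix given by its lower triangle; the blocks above the diagonal are the
  transposes of those below.\<close>

definition sym_block3 ::
  "real ^ 'a ^ 'a \<Rightarrow>
   real ^ 'a ^ 'b \<Rightarrow> real ^ 'b ^ 'b \<Rightarrow>
   real ^ 'a ^ 'c \<Rightarrow> real ^ 'b ^ 'c \<Rightarrow> real ^ 'c ^ 'c \<Rightarrow>
   real ^ (('a + 'b) + 'c) ^ (('a + 'b) + 'c)" where
  "sym_block3 M11 M21 M22 M31 M32 M33 =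
     vstack (vstack (hstack (hstack M11 (transpose M21)) (transpose M31))
                    (hstack (hstack M21 M22) (transpose M32)))
            (hstack (hstack M31 M32) M33)"

definition pos_def :: "real ^ 'n ^ 'n \<Rightarrow> bool" where
  "pos_def M \<longleftrightarrow> transpose M = M \<and> (\<forall>v. v \<noteq> 0 \<longrightarrow> 0 < v \<bullet> (M *v v))"

definition pos_semidef :: "real ^ 'n ^ 'n \<Rightarrow> bool" where
  "pos_semidef M \<longleftrightarrow> transpose M = M \<and> (\<forall>v. 0 \<le> v \<bullet> (M *v v))"

definition loewner_le :: "real ^ 'n ^ 'n \<Rightarrow> real ^ 'n ^ 'n \<Rightarrow> bool"  (infix "\<preceq>\<^sub>L" 50) where
  "M \<preceq>\<^sub>L N \<longleftrightarrow> pos_semidef (N - M)"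

definition Z_of :: "(real ^ 'n \<Rightarrow> real ^ 'k) \<Rightarrow> real ^ 'n \<Rightarrow> real ^ ('n + 'k)" where
  "Z_of Q x = vstack x (Q x)"

definition ZZ_of ::
  "(real ^ 'n \<Rightarrow> real ^ 'k) \<Rightarrow> real ^ 'n \<Rightarrow> real ^ 'p \<Rightarrow> real ^ (('n + 'p) + 'k)" where
  "ZZ_of Q x \<xi> = vstack (vstack x \<xi>) (Q x)"

definition continuously_differentiable ::
  "(real ^ 'n \<Rightarrow> real ^ 'm) \<Rightarrow> bool" where
  "continuously_differentiable g \<longleftrightarrow>
     (\<forall>x. g differentiable (at x)) \<and> continuous_on UNIV (\<lambda>x. jacobian g (at x))"

definition solves_on ::
  "('a::real_normed_vector \<Rightarrow> 'a) \<Rightarrow> real set \<Rightarrow> (real \<Rightarrow> 'a) \<Rightarrow> bool" where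
  "solves_on F J z \<longleftrightarrow> (\<forall>t\<in>J. (z has_vector_derivative F (z t)) (at t within J))"

definition forward_interval :: "real set \<Rightarrow> bool" where
  "forward_interval J \<longleftrightarrow> is_interval J \<and> 0 \<in> J \<and> J \<subseteq> {0..}"

text \<open>Solutions from time \<open>0\<close> that cannot be continued further forward in time. Values of \<open>z\<close>
  outside \<open>J\<close> are irrelevant.\<close>

definition maximal_solution ::
  "('a::real_normed_vector \<Rightarrow> 'a) \<Rightarrow> real set \<Rightarrow> (real \<Rightarrow> 'a) \<Rightarrow> bool" where
  "maximal_solution F J z \<longleftrightarrow>
     forward_interval J \<and> solves_on F J z \<and>
     (\<forall>J' z'. forward_interval J' \<and> J \<subseteq> J' \<and> solves_on F J' z' \<and> (\<forall>t\<in>J. z' t = z t)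
        \<longrightarrow> J' = J)"

text \<open>Closed loop of the plant and the integrator of the error \<open>h x - r\<close> under the feedback
  with gain \<open>K\<close>.\<close>

definition closed_loop ::
  "(real ^ 'n \<Rightarrow> real ^ 'n) \<Rightarrow> (real ^ 'n \<Rightarrow> real ^ 'p) \<Rightarrow>
   real ^ 'm ^ 'n \<Rightarrow> real ^ 'q ^ 'n \<Rightarrow> real ^ 'q \<Rightarrow> real ^ 'p \<Rightarrow>
   (real ^ 'n \<Rightarrow> real ^ 'k) \<Rightarrow> real ^ (('n + 'p) + 'k) ^ 'm \<Rightarrow>
   (real ^ 'n) \<times> (real ^ 'p) \<Rightarrow> (real ^ 'n) \<times> (real ^ 'p)" where
  "closed_loop f h B E d r Q K = (\<lambda>(x, \<xi>). (f x + B *v (K *v ZZ_of Q x \<xi>) + E *v d, h x - r))"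

end

(*
Put z = (x, xi) and eta(z) = Y1 P^-1 z + G2 Q(x). The equality constraints say that
Z0 eta(z) = (x, xi, Q(x)) and that the entries of eta(z) sum to 0, so the data equation cancels
the unknown A, B, C, d and the closed loop becomes z' = Z1 eta(z) + const.
The bound on the Jacobian of Q gives |Q(x) - Q(x')| <= |R_Q^T (x - x')|; hence the vector field F
is globally Lipschitz, and evaluating the matrix inequality at (P^-1 w, Q(x) - Q(x'), R_Q^T (x - x'))
for w = z - z' gives 2 (P^-1 w) . (F z - F z') <= - alpha |P^-1 w|^2. So F contracts the metric
P^-1: it has a zero, to which all solutions converge exponentially, and the last component of
F = 0 reads h(x) = r there.
*)

theory Submission
  imports Defs
begin

section \<open>Global existence for Lipschitz vector fields\<close>

lemma solves_on_subset:
  assumes "solves_on F J z" "I \<subseteq> J"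
  shows "solves_on F I z"
  using assms unfolding solves_on_def
  by (meson has_vector_derivative_within_subset subset_iff)

text \<open>Integrating the weight \<open>exp (k * s)\<close> gains a factor \<open>1 / k\<close>; a
  large \<open>k\<close> thereby turns the integral operator of an ODE into a contraction.\<close>

lemma integral_norm_bound_exp:
  fixes g :: "real \<Rightarrow> 'a::euclidean_space"
  assumes "continuous_on {0..\<tau>} g" "0 \<le> \<tau>" "0 < k" "0 \<le> C"
    and bound: "\<And>s. s \<in> {0..\<tau>} \<Longrightarrow> norm (g s) \<le> C * exp (k * s)"
  shows "norm (integral {0..\<tau>} g) \<le> C / k * exp (k * \<tau>)"
proof -
  have "((\<lambda>s. C * exp (k * s)) has_integral (C / k * exp (k * \<tau>) - C / k * exp (k * 0))) {0..\<tau>}"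
    using assms
    by (intro fundamental_theorem_of_calculus)
       (auto intro!: derivative_eq_intros
             simp flip: has_real_derivative_iff_has_vector_derivative)
  then have "norm (integral {0..\<tau>} g) \<le> C / k * exp (k * \<tau>) - C / k * exp (k * 0)"
    using integral_norm_bound_integral[OF integrable_continuous_real[OF assms(1)] _ bound]
    by (metis has_integral_integrable_integral)
  also have "\<dots> \<le> C / k * exp (k * \<tau>)"
    using assms by simp
  finally show ?thesis .
qed

text \<open>Picard iteration on the whole half-line at once: writing the solution as
  \<open>exp (k t) u t\<close> with \<open>u\<close> bounded (Bielecki's norm), the integral operator
  contracts by the factor \<open>L / k\<close>.\<close>

lemma lipschitz_global_solution:
  fixes F :: "'a::euclidean_space \<Rightarrow> 'a"
  assumes lip: "L-lipschitz_on UNIV F"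
  shows "\<exists>z. z 0 = z0 \<and> solves_on F {0..} z"
proof -
  \<comment> \<open>Twice the Lipschitz constant gives the contraction factor \<open>1 / 2\<close>;
    the added 1 keeps \<open>k\<close> positive when \<open>L = 0\<close>.\<close>
  define k where "k = 2 * L + 1"
  have L0: "0 \<le> L" using lip by (rule lipschitz_on_nonneg)
  then have k: "0 < k" "L / k \<le> 1 / 2" by (auto simp: k_def field_simps)
  have contF: "continuous_on UNIV F" using lip by (rule lipschitz_on_continuous_on)
  have nF: "norm (F x - F y) \<le> L * norm (x - y)" for x y
    using lipschitz_onD[OF lip, of x y] by (simp add: dist_norm)
  define G where "G u s = F (exp (k * s) *\<^sub>R apply_bcontfun u s)" for u :: "real \<Rightarrow>\<^sub>C 'a" and s
  have contG: "continuous_on S (G u)" for u S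
    unfolding G_def
    by (rule continuous_on_compose2[OF contF]) (auto intro!: continuous_intros)
  have intG: "G u integrable_on {0..t}" for u t
    by (rule integrable_continuous_real[OF contG])
  \<comment> \<open>Bounded continuous functions here live on the whole real line, so
    \<open>max 0 t\<close> extends the operator constantly to negative times.\<close>
  define \<Phi> where "\<Phi> u t = exp (- k * max 0 t) *\<^sub>R (z0 + integral {0..max 0 t} (G u))" for u t
  have cont: "continuous_on UNIV (\<Phi> u)" for u
  proof -
    \<comment> \<open>Continuity of the indefinite integral comes on compact intervals; near
      \<open>x\<close> the interval \<open>{0..x + 1}\<close> coincides with the half-line. The
      derivative of \<open>z\<close> is obtained below in the same way.\<close>
    have "continuous (at x within {0..}) (\<lambda>t. integral {0..t} (G u))" if "0 \<le> x" for x
    proof -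
      have "continuous_on {0..x + 1} (\<lambda>t. integral {0..t} (G u))"
        by (rule indefinite_integral_continuous_1[OF intG])
      then have "continuous (at x within {0..x + 1}) (\<lambda>t. integral {0..t} (G u))"
        using that by (simp add: continuous_on_eq_continuous_within)
      moreover have "at x within {0..x + 1} = at x within {0..}"
        by (rule at_within_nhd[of x "{..<x + 1}"]) auto
      ultimately show ?thesis by simp
    qed
    then have "continuous_on {0..} (\<lambda>t. integral {0..t} (G u))"
      by (simp add: continuous_on_eq_continuous_within)
    then have "continuous_on UNIV (\<lambda>t. integral {0..max 0 t} (G u))"
      by (rule continuous_on_compose2) (auto intro!: continuous_intros)
    then show ?thesis unfolding \<Phi>_def by (intro continuous_intros)
  qed
  have shrink: "exp (- k * \<tau>) * norm (integral {0..\<tau>} g) \<le> C / k"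
    if "continuous_on {0..\<tau>} g" "0 \<le> \<tau>" "0 \<le> C"
      "\<And>s. s \<in> {0..\<tau>} \<Longrightarrow> norm (g s) \<le> C * exp (k * s)" for \<tau> C and g :: "real \<Rightarrow> 'a"
  proof -
    have "exp (- k * \<tau>) * norm (integral {0..\<tau>} g) \<le> exp (- k * \<tau>) * (C / k * exp (k * \<tau>))"
      using integral_norm_bound_exp[OF that(1,2) k(1) that(3,4)] by (intro mult_left_mono) auto
    also have "\<dots> = C / k" by (simp add: exp_minus field_simps)
    finally show ?thesis .
  qed
  have bd: "norm (\<Phi> u t) \<le> norm z0 + (norm (F 0) + L * norm u) / k" for u t
  proof -
    define \<tau> where "\<tau> = max 0 t"
    have \<tau>: "0 \<le> \<tau>" by (simp add: \<tau>_def)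
    \<comment> \<open>Linear growth of \<open>F\<close> suffices: the constant part
      \<open>norm (F 0)\<close> is absorbed into the weight because \<open>exp (k * s)\<close> is at
      least 1.\<close>
    have g: "norm (G u s) \<le> (norm (F 0) + L * norm u) * exp (k * s)" if "s \<in> {0..\<tau>}" for s
    proof -
      have "norm (G u s) \<le> norm (F 0) + L * norm (exp (k * s) *\<^sub>R apply_bcontfun u s)"
        using nF[of "exp (k * s) *\<^sub>R apply_bcontfun u s" 0]
          norm_triangle_ineq[of "F 0" "G u s - F 0"]
        by (simp add: G_def)
      also have "\<dots> \<le> norm (F 0) * exp (k * s) + L * (exp (k * s) * norm u)"
      proof (rule add_mono)
        show "norm (F 0) \<le> norm (F 0) * exp (k * s)"
          using that k by (simp add: mult_le_cancel_left1)
        show "L * norm (exp (k * s) *\<^sub>R apply_bcontfun u s) \<le> L * (exp (k * s) * norm u)"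
          using L0 norm_bounded[of u s] by (auto intro!: mult_left_mono)
      qed
      finally show ?thesis by (simp add: algebra_simps)
    qed
    have "norm (\<Phi> u t) \<le> exp (- k * \<tau>) * (norm z0 + norm (integral {0..\<tau>} (G u)))"
      unfolding \<Phi>_def \<tau>_def[symmetric] by (simp add: norm_triangle_ineq)
    also have "\<dots> \<le> norm z0 + (norm (F 0) + L * norm u) / k"
      unfolding distrib_left
    proof (rule add_mono)
      show "exp (- k * \<tau>) * norm z0 \<le> norm z0" using \<tau> k by (simp add: mult_left_le_one_le)
      show "exp (- k * \<tau>) * norm (integral {0..\<tau>} (G u)) \<le> (norm (F 0) + L * norm u) / k"
        using g L0 by (intro shrink \<tau> contG) auto
    qed
    finally show ?thesis .
  qed
  have in_bc: "\<Phi> u \<in> bcontfun" for u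
    by (rule bcontfun_normI[OF cont bd])
  define T where "T u = Bcontfun (\<Phi> u)" for u
  have T: "apply_bcontfun (T u) t = \<Phi> u t" for u t
    by (simp add: T_def Bcontfun_inverse in_bc)
  have "dist (T u) (T v) \<le> 1 / 2 * dist u v" for u v
  proof (rule dist_bound)
    fix t :: real
    define \<tau> where "\<tau> = max 0 t"
    have \<tau>: "0 \<le> \<tau>" by (simp add: \<tau>_def)
    have g: "norm (G u s - G v s) \<le> (L * dist u v) * exp (k * s)" for s
    proof -
      have "norm (G u s - G v s) \<le> L * (exp (k * s) * dist (apply_bcontfun u s) (apply_bcontfun v s))"
        using nF[of "exp (k * s) *\<^sub>R apply_bcontfun u s" "exp (k * s) *\<^sub>R apply_bcontfun v s"]
        by (simp add: G_def dist_norm flip: scaleR_diff_right)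
      also have "\<dots> \<le> L * (exp (k * s) * dist u v)"
        using L0 by (intro mult_left_mono dist_bounded) auto
      finally show ?thesis by (simp add: algebra_simps)
    qed
    have "\<Phi> u t - \<Phi> v t = exp (- k * \<tau>) *\<^sub>R integral {0..\<tau>} (\<lambda>s. G u s - G v s)"
      unfolding \<Phi>_def \<tau>_def[symmetric]
      by (subst Henstock_Kurzweil_Integration.integral_diff[OF intG intG])
         (simp add: algebra_simps)
    then have "dist (T u t) (T v t) = exp (- k * \<tau>) * norm (integral {0..\<tau>} (\<lambda>s. G u s - G v s))"
      by (simp add: T dist_norm)
    also have "\<dots> \<le> (L * dist u v) / k"
      using g L0 by (intro shrink \<tau> continuous_on_diff contG) auto
    also have "\<dots> \<le> 1 / 2 * dist u v"
      using mult_right_mono[OF k(2), of "dist u v"] by simp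
    finally show "dist (T u t) (T v t) \<le> 1 / 2 * dist u v" .
  qed
  then obtain u where u: "T u = u"
    using banach_fix_type[of "1 / 2" T] by auto
  define z where "z t = exp (k * t) *\<^sub>R apply_bcontfun u t" for t
  \<comment> \<open>Undoing the weight turns the fixed point equation into the integral form of the
    initial value problem.\<close>
  have z_eq: "z t = z0 + integral {0..t} (\<lambda>s. F (z s))" if "0 \<le> t" for t
  proof -
    have "z t = exp (k * t) *\<^sub>R \<Phi> u t" using T[of u t] by (simp add: u z_def)
    moreover have "G u = (\<lambda>s. F (z s))" by (simp add: G_def z_def fun_eq_iff)
    ultimately show ?thesis using that by (simp add: \<Phi>_def max_absorb2 exp_minus)
  qed
  have contz: "continuous_on S (\<lambda>s. F (z s))" for S
    using contG[of S u] by (simp add: G_def z_def)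
  have "(z has_vector_derivative F (z t)) (at t within {0..})" if "0 \<le> t" for t
  proof -
    have "((\<lambda>t. z0 + integral {0..t} (\<lambda>s. F (z s))) has_vector_derivative F (z t))
        (at t within {0..t + 1})"
      using that by (auto intro!: derivative_eq_intros integral_has_vector_derivative contz)
    then have "(z has_vector_derivative F (z t)) (at t within {0..t + 1})"
      by (rule has_vector_derivative_transform[rotated 2]) (use that z_eq in auto)
    moreover have "at t within {0..t + 1} = at t within {0..}"
      by (rule at_within_nhd[of t "{..<t + 1}"]) auto
    ultimately show ?thesis by simp
  qed
  moreover have "z 0 = z0" using z_eq[of 0] by simp
  ultimately show ?thesis by (auto simp: solves_on_def)
qed

section \<open>Contraction in a quadratic metric\<close>

text \<open>The form attains a positive minimum on the compact unit sphere; homogeneity of degree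
  two carries this minimum to all vectors.\<close>

lemma quadratic_form_lower_bound:
  fixes S :: "'a::euclidean_space \<Rightarrow> 'a"
  assumes lin: "linear S" and pos: "\<And>w. w \<noteq> 0 \<Longrightarrow> 0 < w \<bullet> S w"
  shows "\<exists>m>0. \<forall>w. m * (norm w)\<^sup>2 \<le> w \<bullet> S w"
proof -
  have "continuous_on (sphere 0 1) (\<lambda>w. w \<bullet> S w)"
    using lin by (intro continuous_intros linear_continuous_on) (simp add: linear_conv_bounded_linear)
  moreover have "sphere (0::'a) 1 \<noteq> {}" by simp
  ultimately obtain w0 where w0: "w0 \<in> sphere 0 1"
    and min: "\<And>w. w \<in> sphere 0 1 \<Longrightarrow> w0 \<bullet> S w0 \<le> w \<bullet> S w"
    using continuous_attains_inf[OF compact_sphere, of 0 1 "\<lambda>w. w \<bullet> S w"] by blast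
  show ?thesis
  proof (intro exI conjI allI)
    show "0 < w0 \<bullet> S w0" using w0 by (intro pos) auto
    show "(w0 \<bullet> S w0) * (norm w)\<^sup>2 \<le> w \<bullet> S w" for w
    proof (cases "w = 0")
      case False
      have "w0 \<bullet> S w0 \<le> (w /\<^sub>R norm w) \<bullet> S (w /\<^sub>R norm w)"
        using False by (intro min) simp
      also have "\<dots> = (w \<bullet> S w) / (norm w)\<^sup>2"
        by (simp add: linear_scale[OF lin] power2_eq_square divide_inverse)
      finally show ?thesis using False by (simp add: field_simps)
    qed (simp add: linear_0[OF lin])
  qed
qed

text \<open>The squared \<open>S\<close>-distance of two solutions is a Lyapunov function: it decays
  at rate \<open>k\<close>, and its equivalence with the Euclidean norm yields the factor
  \<open>N\<close>. Equal initial values give uniqueness; a constant solution gives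
  convergence.\<close>

lemma contracting_solutions:
  fixes F :: "'a::euclidean_space \<Rightarrow> 'a"
  assumes lin: "linear S" and sym: "\<And>x y. S x \<bullet> y = x \<bullet> S y"
    and pos: "\<And>w. w \<noteq> 0 \<Longrightarrow> 0 < w \<bullet> S w"
    and c: "0 < c" and contr: "\<And>x y. S (x - y) \<bullet> (F x - F y) \<le> - c * (norm (x - y))\<^sup>2"
  obtains N k where "0 < k"
    "\<And>t z z'. \<lbrakk>0 \<le> t; solves_on F {0..t} z; solves_on F {0..t} z'\<rbrakk>
       \<Longrightarrow> (norm (z t - z' t))\<^sup>2 \<le> N * (norm (z 0 - z' 0))\<^sup>2 * exp (- k * t)"
proof -
  obtain m where m: "0 < m" "\<And>w. m * (norm w)\<^sup>2 \<le> w \<bullet> S w"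
    using quadratic_form_lower_bound[OF lin pos] by auto
  have bl: "bounded_linear S" using lin by (simp add: linear_conv_bounded_linear)
  obtain M where M: "0 < M" "\<And>w. norm (S w) \<le> norm w * M"
    using bounded_linear.pos_bounded[OF bl] by auto
  have WM: "w \<bullet> S w \<le> M * (norm w)\<^sup>2" for w
  proof -
    have "w \<bullet> S w \<le> norm w * norm (S w)" by (rule norm_cauchy_schwarz)
    also have "\<dots> \<le> norm w * (norm w * M)" using M by (intro mult_left_mono) auto
    finally show ?thesis by (simp add: power2_eq_square algebra_simps)
  qed
  \<comment> \<open>The squared \<open>S\<close>-distance has derivative at most
    \<open>- 2 * c * (norm w)\<^sup>2\<close>, and \<open>M\<close> bounds the form from above, so
    this is a decay rate that the contraction condition guarantees.\<close>
  define k where "k = 2 * c / M"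
  show ?thesis
  proof (rule that[of k "M / m"])
    show "0 < k" using c M by (simp add: k_def)
    fix t and z z' :: "real \<Rightarrow> 'a"
    assume t: "0 \<le> t" and z: "solves_on F {0..t} z" and z': "solves_on F {0..t} z'"
    define w where "w s = z s - z' s" for s
    define W where "W = (\<lambda>s. exp (k * s) * (w s \<bullet> S (w s)))"
    \<comment> \<open>The Frechet derivative of \<open>W\<close> at \<open>s\<close> in direction
      \<open>h\<close>, the shape needed by the mean value theorem.\<close>
    define W' where "W' s h = h * (exp (k * s) * (k * (w s \<bullet> S (w s))
        + 2 * (S (w s) \<bullet> (F (z s) - F (z' s)))))" for s h
    have "(W has_derivative W' s) (at s within {0..t})" if "0 \<le> s" "s \<le> t" for s
    proof -
      define D where "D = F (z s) - F (z' s)"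
      have sD: "w s \<bullet> S D = S (w s) \<bullet> D" "D \<bullet> S (w s) = S (w s) \<bullet> D"
        by (simp add: sym) (rule inner_commute)
      have dw: "(w has_derivative (\<lambda>h. h *\<^sub>R D)) (at s within {0..t})"
        using z z' that unfolding solves_on_def w_def D_def has_vector_derivative_def
        by (auto intro!: derivative_eq_intros simp: scaleR_diff_right)
      have dS: "((\<lambda>s. S (w s)) has_derivative (\<lambda>h. S (h *\<^sub>R D))) (at s within {0..t})"
        by (rule bounded_linear.has_derivative[OF bl dw])
      have de: "((\<lambda>s. exp (k * s)) has_derivative (\<lambda>h. h * (k * exp (k * s)))) (at s within {0..t})"
        by (auto intro!: derivative_eq_intros)
      have "((\<lambda>s. w s \<bullet> S (w s)) has_derivative (\<lambda>h. w s \<bullet> S (h *\<^sub>R D) + (h *\<^sub>R D) \<bullet> S (w s)))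
          (at s within {0..t})"
        by (rule has_derivative_inner[OF dw dS])
      from has_derivative_mult[OF de this] show ?thesis
        unfolding W_def
        by (rule has_derivative_eq_rhs)
           (auto simp: fun_eq_iff algebra_simps linear_scale[OF lin] sD W'_def simp flip: D_def)
    qed
    then obtain s where s: "s \<in> {0..t}"
      and "W t - W 0 = W' s (t - 0)"
      using mvt_very_simple[OF t, of W W'] by blast
    moreover have "k * (w s \<bullet> S (w s)) + 2 * (S (w s) \<bullet> (F (z s) - F (z' s))) \<le> 0"
    proof -
      have "k * (w s \<bullet> S (w s)) \<le> k * (M * (norm (w s))\<^sup>2)"
        using c M by (intro mult_left_mono WM) (simp add: k_def)
      also have "\<dots> = 2 * c * (norm (w s))\<^sup>2" using M by (simp add: k_def)
      finally show ?thesis using contr[of "z s" "z' s"] by (simp add: w_def)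
    qed
    then have "W' s (t - 0) \<le> 0"
      using t unfolding W'_def by (intro mult_nonneg_nonpos) auto
    ultimately have "W t \<le> W 0" by simp
    then have "w t \<bullet> S (w t) \<le> exp (- k * t) * (w 0 \<bullet> S (w 0))"
      by (simp add: W_def exp_minus field_simps)
    also have "\<dots> \<le> exp (- k * t) * (M * (norm (w 0))\<^sup>2)" by (intro mult_left_mono WM) simp
    finally show "(norm (z t - z' t))\<^sup>2 \<le> M / m * (norm (z 0 - z' 0))\<^sup>2 * exp (- k * t)"
      using m(1) m(2)[of "w t"] by (simp add: w_def field_simps)
  qed
qed

text \<open>The damped map \<open>z \<mapsto> z + \<epsilon> S (F z)\<close> contracts the Euclidean norm for small \<open>\<epsilon>\<close>; its
  fixed point is a zero of \<open>F\<close>, since \<open>S\<close> is injective.\<close>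

lemma contracting_equilibrium:
  fixes F :: "'a::euclidean_space \<Rightarrow> 'a"
  assumes lin: "linear S" and sym: "\<And>x y. S x \<bullet> y = x \<bullet> S y"
    and pos: "\<And>w. w \<noteq> 0 \<Longrightarrow> 0 < w \<bullet> S w"
    and c: "0 < c" and contr: "\<And>x y. S (x - y) \<bullet> (F x - F y) \<le> - c * (norm (x - y))\<^sup>2"
    and lip: "L-lipschitz_on UNIV F"
  shows "\<exists>z. F z = 0"
proof -
  obtain M where M: "0 < M" "\<And>w. norm (S w) \<le> norm w * M"
    using bounded_linear.pos_bounded lin linear_conv_bounded_linear by blast
  have L0: "0 \<le> L" using lip by (rule lipschitz_on_nonneg)
  \<comment> \<open>\<open>L * M\<close> is a Lipschitz constant of the map \<open>S\<close> after
    \<open>F\<close>; adding \<open>c\<close> makes \<open>L'\<close> positive and at least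
    \<open>c\<close>, so that \<open>q\<close> below is nonnegative.\<close>
  define L' where "L' = L * M + c"
  have L': "0 < L'" "c \<le> L'" using L0 M c by (auto simp: L'_def intro: add_nonneg_pos)
  \<comment> \<open>This step size minimizes
    \<open>1 - 2 * \<epsilon> * c + \<epsilon>\<^sup>2 * L'\<^sup>2\<close>, the bound on the
    squared contraction factor; the minimum is \<open>q\<close>.\<close>
  define \<epsilon> where "\<epsilon> = c / L'\<^sup>2"
  define q where "q = 1 - (c / L')\<^sup>2"
  have "(c / L')\<^sup>2 \<le> 1" using L' c by (simp add: power_le_one)
  then have q: "0 \<le> q" "q < 1" using L' c by (auto simp: q_def)
  define G where "G z = z + \<epsilon> *\<^sub>R S (F z)" for z
  have "dist (G x) (G y) \<le> sqrt q * dist x y" for x y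
  proof -
    define w where "w = x - y"
    define g where "g = S (F x - F y)"
    have "norm g \<le> norm (F x - F y) * M" unfolding g_def by (rule M)
    also have "\<dots> \<le> L * norm w * M"
      using lipschitz_onD[OF lip, of x y] M by (simp add: dist_norm w_def)
    also have "\<dots> \<le> L' * norm w" using c by (simp add: L'_def algebra_simps)
    finally have g: "(norm g)\<^sup>2 \<le> L'\<^sup>2 * (norm w)\<^sup>2"
      by (metis norm_ge_zero power_mono power_mult_distrib)
    have wg: "w \<bullet> g \<le> - c * (norm w)\<^sup>2" using contr[of x y] by (simp add: w_def g_def sym)
    have "(norm (w + \<epsilon> *\<^sub>R g))\<^sup>2 = (norm w)\<^sup>2 + 2 * \<epsilon> * (w \<bullet> g) + \<epsilon>\<^sup>2 * (norm g)\<^sup>2"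
      unfolding power2_norm_eq_inner
      by (simp add: inner_add inner_commute[of g w] power2_eq_square algebra_simps)
    also have "\<dots> \<le> (norm w)\<^sup>2 + 2 * \<epsilon> * (- c * (norm w)\<^sup>2) + \<epsilon>\<^sup>2 * (L'\<^sup>2 * (norm w)\<^sup>2)"
      using c L' wg g by (intro add_mono mult_left_mono) (auto simp: \<epsilon>_def)
    also have "\<dots> = q * (norm w)\<^sup>2"
      using L' by (simp add: \<epsilon>_def q_def field_simps power2_eq_square)
    finally have "norm (w + \<epsilon> *\<^sub>R g) \<le> sqrt (q * (norm w)\<^sup>2)" by (rule real_le_rsqrt)
    then show ?thesis
      by (simp add: dist_norm G_def w_def g_def linear_diff[OF lin] real_sqrt_mult algebra_simps)
  qed
  then obtain z where "G z = z"
    using banach_fix_type[of "sqrt q" G] q by auto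
  then have "S (F z) = 0" using c L' by (simp add: G_def \<epsilon>_def)
  then show ?thesis using pos[of "F z"] by force
qed

theorem contracting_global_convergence:
  fixes F :: "'a::euclidean_space \<Rightarrow> 'a"
  assumes lin: "linear S" and sym: "\<And>x y. S x \<bullet> y = x \<bullet> S y"
    and pos: "\<And>w. w \<noteq> 0 \<Longrightarrow> 0 < w \<bullet> S w"
    and c: "0 < c" and contr: "\<And>x y. S (x - y) \<bullet> (F x - F y) \<le> - c * (norm (x - y))\<^sup>2"
    and lip: "L-lipschitz_on UNIV F"
  obtains e where "F e = 0"
    "\<And>J z. maximal_solution F J z \<Longrightarrow> J = {0..} \<and> bounded (z ` {0..}) \<and> (z \<longlongrightarrow> e) at_top"
proof -
  obtain e where e: "F e = 0"
    using contracting_equilibrium[OF lin sym pos c contr lip] by auto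
  obtain N k where k: "0 < k" and dec:
    "\<And>t z z'. \<lbrakk>0 \<le> t; solves_on F {0..t} z; solves_on F {0..t} z'\<rbrakk>
       \<Longrightarrow> (norm (z t - z' t))\<^sup>2 \<le> N * (norm (z 0 - z' 0))\<^sup>2 * exp (- k * t)"
    using contracting_solutions[OF lin sym pos c contr] by metis
  show ?thesis
  proof (rule that[OF e])
    fix J z assume max: "maximal_solution F J z"
    then have J: "forward_interval J" and z: "solves_on F J z"
      by (auto simp: maximal_solution_def)
    obtain z' where z': "z' 0 = z 0" "solves_on F {0..} z'"
      using lipschitz_global_solution[OF lip] by metis
    \<comment> \<open>Equal initial values make the decay estimate vanish, so the global solution
      extends \<open>z\<close> and maximality leaves only the full half-line.\<close>
    have "z' t = z t" if "t \<in> J" for t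
    proof -
      have t: "0 \<le> t" "{0..t} \<subseteq> J"
        using J that by (auto simp: forward_interval_def is_interval_1)
      then show ?thesis
        using dec[of t z z'] solves_on_subset[OF z] solves_on_subset[OF z'(2), of "{0..t}"] z'(1)
        by auto
    qed
    moreover have "forward_interval {0..}" "J \<subseteq> {0..}"
      using J by (auto simp: forward_interval_def is_interval_1)
    ultimately have J0: "J = {0..}"
      using max z'(2) unfolding maximal_solution_def by metis
    have const: "solves_on F I (\<lambda>_. e)" for I
      by (auto simp: solves_on_def e)
    have bd: "(norm (z t - e))\<^sup>2 \<le> N * (norm (z 0 - e))\<^sup>2 * exp (- k * t)" if "0 \<le> t" for t
      using dec[OF that solves_on_subset[OF z] const] by (auto simp: J0)
    have "((\<lambda>t. (norm (z t - e))\<^sup>2) \<longlongrightarrow> 0) at_top"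
    proof (rule tendsto_sandwich[where f="\<lambda>_. 0"])
      show "((\<lambda>t. N * (norm (z 0 - e))\<^sup>2 * exp (- k * t)) \<longlongrightarrow> 0) at_top"
      proof (rule tendsto_mult_right_zero)
        have "filterlim (\<lambda>t. - (k * t)) at_bot at_top"
          using k by (auto simp: filterlim_uminus_at_bot intro!: filterlim_tendsto_pos_mult_at_top
              filterlim_ident)
        then show "((\<lambda>t. exp (- k * t)) \<longlongrightarrow> 0) at_top"
          using filterlim_compose[OF exp_at_bot] by simp
      qed
      show "\<forall>\<^sub>F t in at_top. (norm (z t - e))\<^sup>2 \<le> N * (norm (z 0 - e))\<^sup>2 * exp (- k * t)"
        using eventually_ge_at_top[of 0] by eventually_elim (rule bd)
    qed auto
    then have "((\<lambda>t. norm (z t - e)) \<longlongrightarrow> 0) at_top"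
      using tendsto_real_sqrt[of _ 0] by fastforce
    then have "(z \<longlongrightarrow> e) at_top"
      by (simp add: LIM_zero_iff tendsto_norm_zero_iff)
    moreover have "bounded (z ` {0..})"
    proof -
      \<comment> \<open>The absolute value is taken because the sign of \<open>N\<close> is not part
        of the decay estimate.\<close>
      define D where "D = \<bar>N\<bar> * (norm (z 0 - e))\<^sup>2"
      have "norm (z t) \<le> norm e + sqrt D" if "0 \<le> t" for t
      proof -
        have "(norm (z t - e))\<^sup>2 \<le> D * exp (- k * t)"
          using bd[OF that] unfolding D_def
          by (smt (verit) exp_ge_zero mult_right_mono zero_le_power2)
        also have "\<dots> \<le> D"
          using that k by (simp add: D_def mult_left_le)
        finally show ?thesis
          using real_le_rsqrt norm_triangle_sub[of "z t" e] by force
      qed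
      then show ?thesis by (auto simp: bounded_iff)
    qed
    ultimately show "J = {0..} \<and> bounded (z ` {0..}) \<and> (z \<longlongrightarrow> e) at_top" using J0 by simp
  qed
qed

section \<open>Algebra of stacked vectors and block matrices\<close>

lemma vstack_nth [simp]: "vstack x y $ Inl a = x $ a" "vstack x y $ Inr b = y $ b"
  by (simp_all add: vstack_def)

lemma vec_sum_eq_iff:
  fixes v w :: "'a ^ ('m::finite + 'n::finite)"
  shows "v = w \<longleftrightarrow> (\<forall>i. v $ Inl i = w $ Inl i) \<and> (\<forall>j. v $ Inr j = w $ Inr j)"
  by (metis old.sum.exhaust vec_eq_iff)

lemma sum_UNIV_Plus:
  fixes g :: "'m::finite + 'n::finite \<Rightarrow> 'a::comm_monoid_add"
  shows "(\<Sum>i\<in>UNIV. g i) = (\<Sum>i\<in>UNIV. g (Inl i)) + (\<Sum>j\<in>UNIV. g (Inr j))"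
  by (simp add: UNIV_Plus_UNIV[symmetric] sum.Plus del: UNIV_Plus_UNIV)

lemma inner_vstack: "vstack a b \<bullet> vstack c d = a \<bullet> c + b \<bullet> (d :: real ^ _)"
  by (simp add: inner_vec_def sum_UNIV_Plus)

lemma norm_vstack: "norm (vstack a b) = norm (a, b :: real ^ _)"
  by (simp add: norm_eq_sqrt_inner inner_vstack)

lemma vstack_diff: "vstack a b - vstack c d = vstack (a - c) (b - d :: _ :: ab_group_add ^ _)"
  by (simp add: vec_sum_eq_iff)

lemma vstack_add: "vstack a b + vstack c d = vstack (a + c) (b + d :: _ :: ab_group_add ^ _)"
  by (simp add: vec_sum_eq_iff)

lemma vstack_scale: "c *\<^sub>R vstack a b = vstack (c *\<^sub>R a) (c *\<^sub>R b :: real ^ _)"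
  by (simp add: vec_sum_eq_iff)

lemma vstack_sum: "(\<Sum>j\<in>I. vstack (a j) (b j)) = vstack (\<Sum>j\<in>I. a j) (\<Sum>j\<in>I. b j :: real ^ _)"
  by (simp add: vec_sum_eq_iff)

lemma vstack_inject [simp]: "vstack a b = vstack c d \<longleftrightarrow> a = c \<and> b = d"
  by (auto simp: vec_sum_eq_iff vec_eq_iff)

lemma vstack_mult_vec: "vstack M N *v v = vstack (M *v v) (N *v (v :: real ^ _))"
  by (simp add: vec_sum_eq_iff matrix_vector_mult_def)

lemma hstack_mult_vec: "hstack M N *v vstack x y = M *v x + N *v (y :: real ^ _)"
  by (simp add: vec_eq_iff matrix_vector_mult_def hstack_def sum_UNIV_Plus)

lemma from_columns_mult_vec: "from_columns w *v v = (\<Sum>j\<in>UNIV. v $ j *\<^sub>R (w j :: real ^ _))"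
  by (simp add: vec_eq_iff matrix_vector_mult_def from_columns_def mult.commute)

lemma inner_transpose_mult: "x \<bullet> (transpose M *v y) = (M *v x) \<bullet> (y :: real ^ _)"
  by (metis dot_lmul_matrix inner_commute transpose_matrix_vector)

lemma sym_block3_quadratic_form:
  "vstack (vstack u v) w \<bullet> (sym_block3 M11 M21 M22 M31 M32 M33 *v vstack (vstack u v) w)
   = u \<bullet> (M11 *v u) + v \<bullet> (M22 *v v) + w \<bullet> (M33 *v w)
     + 2 * (v \<bullet> (M21 *v u)) + 2 * (w \<bullet> (M31 *v u)) + 2 * (w \<bullet> (M32 *v v))"
  unfolding sym_block3_def vstack_mult_vec hstack_mult_vec inner_vstack inner_add_right
    inner_transpose_mult
  by (simp add: inner_commute)

section \<open>Matrix inequalities and data matrices\<close>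

lemma loewner_le_quadratic_form:
  assumes "M \<preceq>\<^sub>L N"
  shows "v \<bullet> (M *v v) \<le> v \<bullet> (N *v v)"
  using assms
  by (auto simp: loewner_le_def pos_semidef_def matrix_vector_mult_diff_rdistrib inner_diff_right)

text \<open>Along the segment from \<open>y\<close> to \<open>x\<close> the direction is always
  \<open>x - y\<close>, so the pointwise bound on the Jacobian has the same right-hand side
  throughout, and the mean value inequality integrates it.\<close>

lemma jacobian_bound_imp_norm_diff_le:
  fixes Q :: "real ^ 'n \<Rightarrow> real ^ 'k" and R :: "real ^ 'w ^ 'n"
  assumes diff: "\<And>x. Q differentiable (at x)"
    and R: "\<And>x. transpose (jacobian Q (at x)) ** jacobian Q (at x) \<preceq>\<^sub>L R ** transpose R"
  shows "norm (Q x - Q y) \<le> norm (transpose R *v (x - y))"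
proof -
  have J: "norm (jacobian Q (at x) *v v) \<le> norm (transpose R *v v)" for x v
  proof -
    have "v \<bullet> ((transpose (jacobian Q (at x)) ** jacobian Q (at x)) *v v)
        = (norm (jacobian Q (at x) *v v))\<^sup>2"
      by (simp only: matrix_vector_mul_assoc[symmetric] inner_transpose_mult power2_norm_eq_inner)
    moreover have "v \<bullet> ((R ** transpose R) *v v) = (norm (transpose R *v v))\<^sup>2"
      using inner_transpose_mult[of v "transpose R" "transpose R *v v"]
      by (simp only: matrix_vector_mul_assoc[symmetric] transpose_transpose power2_norm_eq_inner)
    ultimately show ?thesis
      using loewner_le_quadratic_form[OF R[of x], of v]
      by (metis norm_ge_zero power2_le_imp_le)
  qed
  define g where "g s = Q (y + s *\<^sub>R (x - y))" for s :: real
  have dg: "(g has_derivative (\<lambda>h. jacobian Q (at (y + s *\<^sub>R (x - y))) *v (h *\<^sub>R (x - y))))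
      (at s within {0..1})" for s
  proof -
    have "((\<lambda>s. y + s *\<^sub>R (x - y)) has_derivative (\<lambda>h. h *\<^sub>R (x - y))) (at s within {0..1})"
      by (auto intro!: derivative_eq_intros)
    moreover have "(Q has_derivative (\<lambda>h. jacobian Q (at (y + s *\<^sub>R (x - y))) *v h))
        (at (y + s *\<^sub>R (x - y)))"
      using diff jacobian_works by blast
    ultimately show ?thesis
      unfolding g_def using has_derivative_compose by blast
  qed
  have "norm (g 1 - g 0) \<le> norm (transpose R *v (x - y)) * norm (1 - 0 :: real)"
  proof (rule differentiable_bound[OF _ dg])
    show "onorm (\<lambda>h. jacobian Q (at (y + s *\<^sub>R (x - y))) *v (h *\<^sub>R (x - y)))
        \<le> norm (transpose R *v (x - y))" for s
      by (rule onorm_le)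
         (metis J matrix_vector_mult_scaleR mult.commute mult_left_mono norm_ge_zero norm_scaleR real_norm_def)
  qed auto
  then show ?thesis by (simp add: g_def)
qed

text \<open>Definiteness makes the kernel trivial, hence \<open>P\<close> invertible. Substituting
  \<open>v = P *v u\<close> transfers positivity to the inverse.\<close>

lemma pos_def_matrix_inv:
  assumes "pos_def P"
  shows "P ** matrix_inv P = mat 1" "matrix_inv P ** P = mat 1" "transpose (matrix_inv P) = matrix_inv P"
    "v \<noteq> 0 \<Longrightarrow> 0 < v \<bullet> (matrix_inv P *v v)"
proof -
  have "P *v v = 0 \<Longrightarrow> v = 0" for v
    using assms unfolding pos_def_def by (metis inner_zero_right less_irrefl)
  then obtain P' where P': "P' ** P = mat 1" using matrix_left_invertible_ker by blast
  then have "invertible P" using invertible_def matrix_left_right_inverse by metis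
  then show r: "P ** matrix_inv P = mat 1" and "matrix_inv P ** P = mat 1"
    unfolding invertible_def matrix_inv_def by (metis (mono_tags, lifting) someI_ex)+
  have "transpose (matrix_inv P) ** P = mat 1"
    using arg_cong[OF r, of transpose] assms by (simp add: matrix_transpose_mul pos_def_def transpose_mat)
  then show s: "transpose (matrix_inv P) = matrix_inv P"
    by (metis matrix_mul_assoc matrix_mul_lid matrix_mul_rid r)
  assume v: "v \<noteq> 0"
  define u where "u = matrix_inv P *v v"
  have vu: "v = P *v u" by (simp add: u_def matrix_vector_mul_assoc r)
  then have "u \<noteq> 0" using v by auto
  then have "0 < u \<bullet> (P *v u)" using assms by (simp add: pos_def_def)
  then show "0 < v \<bullet> (matrix_inv P *v v)" by (simp add: u_def[symmetric] vu[symmetric] inner_commute)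
qed

text \<open>Schur complement in the form needed here: the quadratic form of the block matrix is
  evaluated at \<open>(u, q, R\<^sup>T P u)\<close>.\<close>

lemma lmi_imp_contraction:
  fixes M P :: "real ^ 'a ^ 'a" and N :: "real ^ 'k ^ 'a" and R :: "real ^ 'w ^ 'a"
  assumes "sym_block3 (M + transpose M + \<alpha> *\<^sub>R mat 1) (transpose N) (- mat 1)
      (transpose R ** P) 0 (- mat 1) \<preceq>\<^sub>L 0"
  shows "2 * (u \<bullet> (M *v u + N *v q)) + \<alpha> * (norm u)\<^sup>2
    \<le> (norm q)\<^sup>2 - (norm (transpose R *v (P *v u)))\<^sup>2"
proof -
  define w where "w = transpose R *v (P *v u)"
  have neg: "x \<bullet> (- mat 1 *v x) = - (norm x)\<^sup>2" for x :: "real ^ 'z"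
    using matrix_vector_mult_diff_rdistrib[of 0 "mat 1" x] by (simp add: power2_norm_eq_inner)
  have "u \<bullet> ((M + transpose M + \<alpha> *\<^sub>R mat 1) *v u) = 2 * (u \<bullet> (M *v u)) + \<alpha> * (norm u)\<^sup>2"
    unfolding matrix_vector_mult_add_rdistrib inner_add_right inner_transpose_mult
    by (simp add: inner_commute power2_norm_eq_inner flip: scaleR_matrix_vector_assoc)
  moreover have "q \<bullet> (transpose N *v u) = u \<bullet> (N *v q)"
    unfolding inner_transpose_mult by (rule inner_commute)
  moreover have "w \<bullet> ((transpose R ** P) *v u) = (norm w)\<^sup>2"
    by (simp only: w_def matrix_vector_mul_assoc power2_norm_eq_inner)
  ultimately show ?thesis
    using loewner_le_quadratic_form[OF assms, of "vstack (vstack u q) w"]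
    by (simp add: sym_block3_quadratic_form neg inner_add_right w_def)
qed

text \<open>Any combination \<open>\<eta>\<close> of the samples that reproduces the state and annihilates the constant
  disturbance yields the closed-loop vector field, without knowledge of \<open>A\<close>, \<open>B\<close>, \<open>C\<close>.\<close>

lemma closed_loop_from_data:
  fixes Q :: "real ^ 'n \<Rightarrow> real ^ 'k" and A :: "real ^ ('n + 'k) ^ 'n" and C :: "real ^ ('n + 'k) ^ 'p"
    and B :: "real ^ 'm ^ 'n" and E :: "real ^ 'q ^ 'n"
    and xs :: "'t::finite \<Rightarrow> real ^ 'n" and \<xi>s :: "'t \<Rightarrow> real ^ 'p"
  assumes state: "from_columns (\<lambda>j. ZZ_of Q (xs j) (\<xi>s j)) *v \<eta> = ZZ_of Q x \<xi>"
    and sum0: "(\<Sum>j\<in>UNIV. \<eta> $ j) = 0"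
  shows "from_columns (\<lambda>j. vstack (A *v Z_of Q (xs j) + B *v us j + E *v d) (C *v Z_of Q (xs j))) *v \<eta>
    = vstack (A *v Z_of Q x + B *v (from_columns us *v \<eta>)) (C *v Z_of Q x)"
proof -
  have "(\<Sum>j\<in>UNIV. \<eta> $ j *\<^sub>R xs j) = x" "(\<Sum>j\<in>UNIV. \<eta> $ j *\<^sub>R Q (xs j)) = Q x"
    using state by (simp_all add: from_columns_mult_vec ZZ_of_def vstack_scale vstack_sum)
  then have Z: "(\<Sum>j\<in>UNIV. \<eta> $ j *\<^sub>R Z_of Q (xs j)) = Z_of Q x"
    by (simp add: Z_of_def vstack_scale vstack_sum)
  have lin: "(\<Sum>j\<in>UNIV. \<eta> $ j *\<^sub>R (M *v v j)) = M *v (\<Sum>j\<in>UNIV. \<eta> $ j *\<^sub>R v j)"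
    for M :: "real ^ 'c ^ 'r" and v
    by (simp add: linear_sum[OF matrix_vector_mul_linear] matrix_vector_mult_scaleR)
  have "(\<Sum>j\<in>UNIV. \<eta> $ j *\<^sub>R (E *v d)) = 0"
    using sum0 by (simp flip: scaleR_left.sum)
  then show ?thesis
    by (simp add: from_columns_mult_vec vstack_scale vstack_sum scaleR_add_right sum.distrib lin Z)
qed

text \<open>Smoothness is assumed of \<open>Z_of Q\<close>; \<open>Q\<close> is recovered from it by
  the linear projection to the lower block.\<close>

lemma Z_of_differentiable_imp:
  fixes Q :: "real ^ 'n \<Rightarrow> real ^ 'k"
  assumes "Z_of Q differentiable (at x)"
  shows "Q differentiable (at x)"
proof -
  have "bounded_linear (\<lambda>v :: real ^ ('n + 'k). \<chi> i. v $ Inr i)"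
    by (intro linear_conv_bounded_linear[THEN iffD1] linearI) (simp_all add: vec_eq_iff)
  moreover obtain D where "(Z_of Q has_derivative D) (at x)"
    using assms by (auto simp: differentiable_def)
  ultimately have "((\<lambda>x. \<chi> i. Z_of Q x $ Inr i) has_derivative (\<lambda>h. \<chi> i. D h $ Inr i)) (at x)"
    by (rule bounded_linear.has_derivative)
  moreover have "(\<lambda>x. \<chi> i. Z_of Q x $ Inr i) = Q"
    by (simp add: fun_eq_iff vec_eq_iff Z_of_def)
  ultimately show ?thesis by (auto simp: differentiable_def)
qed

section \<open>Application to the closed loop\<close>

text \<open>Existence from every initial state is part of the conclusion, so the claim about maximal
  solutions is not vacuous; \<open>J = {0..}\<close> excludes finite escape time.\<close>

theorem corollary4:
  fixes f :: "real ^ 'n \<Rightarrow> real ^ 'n"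
    and h :: "real ^ 'n \<Rightarrow> real ^ 'p"
    and Q :: "real ^ 'n \<Rightarrow> real ^ 'k"
    and A :: "real ^ ('n + 'k) ^ 'n"
    and B :: "real ^ 'm ^ 'n"
    and C :: "real ^ ('n + 'k) ^ 'p"
    and E :: "real ^ 'q ^ 'n"
    and d :: "real ^ 'q"
    and r :: "real ^ 'p"
    and a b :: real
    and xd :: "real \<Rightarrow> real ^ 'n"
    and \<xi>d :: "real \<Rightarrow> real ^ 'p"
    and ud :: "real \<Rightarrow> real ^ 'm"
    and ts :: "'t::{finite,linorder} \<Rightarrow> real"
    and U0 :: "real ^ ('t::{finite,linorder}) ^ 'm"
    and Z0 :: "real ^ ('t::{finite,linorder}) ^ (('n + 'p) + 'k)"
    and Z1 :: "real ^ ('t::{finite,linorder}) ^ ('n + 'p)"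
    and R_Q :: "real ^ 'w ^ 'n"
    and RR_Q :: "real ^ 'w ^ ('n + 'p)"
    and P :: "real ^ ('n + 'p) ^ ('n + 'p)"
    and Y1 :: "real ^ ('n + 'p) ^ ('t::{finite,linorder})"
    and G2 :: "real ^ 'k ^ ('t::{finite,linorder})"
    and \<alpha> :: real
    and K :: "real ^ (('n + 'p) + 'k) ^ 'm"
  assumes f_def: "\<And>x. f x = A *v Z_of Q x"
    and h_def: "\<And>x. h x = C *v Z_of Q x"
    and Z_C1: "continuously_differentiable (Z_of Q)"
    and Q_nonlinear: "\<And>i. \<not> linear (\<lambda>x. Q x $ i)"
    \<comment> \<open>experiment: trajectory of the extended system on \<open>{a..b}\<close> and its samples\<close>
    and ab: "a < b"
    and exp_x: "\<And>\<tau>. \<tau> \<in> {a..b} \<Longrightarrow>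
      (xd has_vector_derivative (f (xd \<tau>) + B *v ud \<tau> + E *v d)) (at \<tau> within {a..b})"
    and exp_\<xi>: "\<And>\<tau>. \<tau> \<in> {a..b} \<Longrightarrow>
      (\<xi>d has_vector_derivative (h (xd \<tau>) - r)) (at \<tau> within {a..b})"
    and ts_mono: "strict_mono ts"
    and ts_range: "range ts \<subseteq> {a..b}"
    and U0_def: "U0 = from_columns (\<lambda>j. ud (ts j))"
    and Z1_def: "Z1 = from_columns
      (\<lambda>j. vstack (vector_derivative xd (at (ts j) within {a..b})) (h (xd (ts j))))"
    and Z0_def: "Z0 = from_columns (\<lambda>j. ZZ_of Q (xd (ts j)) (\<xi>d (ts j)))"
    and R_Q: "\<And>x. transpose (jacobian Q (at x)) ** jacobian Q (at x) \<preceq>\<^sub>L R_Q ** transpose R_Q"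
    and RR_Q_def: "RR_Q = vstack R_Q 0"
    \<comment> \<open>feasibility of the semidefinite program\<close>
    and alpha_pos: "\<alpha> > 0"
    and P_pos: "pos_def P"
    and sdp_Y1: "Z0 ** Y1 = vstack P 0"
    and sdp_lmi: "sym_block3
        (Z1 ** Y1 + transpose (Z1 ** Y1) + \<alpha> *\<^sub>R mat 1)
        (transpose G2 ** transpose Z1) (- mat 1)
        (transpose RR_Q ** P) 0 (- mat 1) \<preceq>\<^sub>L 0"
    and sdp_G2: "Z0 ** G2 = vstack 0 (mat 1)"
    and sdp_ones: "((\<chi> i j. 1) :: real ^ ('t::{finite,linorder}) ^ 1) ** hstack Y1 G2 = 0"
    \<comment> \<open>the control gain\<close>
    and K_def: "K = U0 ** hstack (Y1 ** matrix_inv P) G2"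
  shows "(\<forall>x0 \<xi>0. \<exists>x \<xi>. x 0 = x0 \<and> \<xi> 0 = \<xi>0 \<and>
            solves_on (closed_loop f h B E d r Q K) {0..} (\<lambda>t. (x t, \<xi> t))) \<and>
         (\<forall>J x \<xi>. maximal_solution (closed_loop f h B E d r Q K) J (\<lambda>t. (x t, \<xi> t)) \<longrightarrow>
            J = {0..} \<and> bounded (x ` {0..}) \<and> bounded (\<xi> ` {0..}) \<and>
            ((\<lambda>t. h (x t) - r) \<longlongrightarrow> 0) at_top)"
proof -
  define Pi where "Pi = matrix_inv P"
  note Pi = pos_def_matrix_inv[OF P_pos, folded Pi_def]
  define F where "F = closed_loop f h B E d r Q K"
  \<comment> \<open>The closed loop acts on pairs, the matrix inequality on stacked vectors.
    \<open>st\<close> is the isometry between them, and \<open>S\<close> is multiplication by the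
    inverse of \<open>P\<close> carried over to pairs.\<close>
  define st where "st z = vstack (fst z) (snd z)" for z :: "(real ^ 'n) \<times> (real ^ 'p)"
  define S where "S z = ((\<chi> i. (Pi *v st z) $ Inl i), (\<chi> j. (Pi *v st z) $ Inr j))"
    for z :: "(real ^ 'n) \<times> (real ^ 'p)"
  have st_S: "st (S z) = Pi *v st z" for z
    by (simp add: st_def S_def vec_sum_eq_iff)
  have inner_st: "z \<bullet> z' = st z \<bullet> st z'" for z z'
    by (simp add: st_def inner_vstack inner_prod_def)
  have norm_st: "norm (st z) = norm z" for z
    by (simp add: st_def norm_vstack)
  have st_diff: "st (z - z') = st z - st z'" for z z'
    by (simp add: st_def vstack_diff)
  have st_eq_0: "st z = 0 \<longleftrightarrow> z = 0" for z
    using norm_st[of z] by (metis norm_eq_zero)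
  have diffZ: "Z_of Q differentiable (at x)" for x
    using Z_C1 by (simp add: continuously_differentiable_def)
  have diffQ: "Q differentiable (at x)" for x
    using diffZ by (rule Z_of_differentiable_imp)
  define \<eta> where "\<eta> z = Y1 *v (Pi *v st z) + G2 *v Q (fst z)" for z
  \<comment> \<open>The disturbance and the reference survive only as a constant offset, which
    cancels in differences of \<open>F\<close>.\<close>
  have stF: "st (F z) = Z1 *v \<eta> z + vstack (E *v d) (- r)" for z
  proof -
    obtain x \<xi> where z: "z = (x, \<xi>)" by (cases z)
    have "Z0 *v \<eta> z = (Z0 ** Y1) *v (Pi *v st z) + (Z0 ** G2) *v Q x"
      by (simp add: \<eta>_def z matrix_vector_right_distrib matrix_vector_mul_assoc matrix_mul_assoc)
    also have "\<dots> = ZZ_of Q x \<xi>"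
      unfolding sdp_Y1 sdp_G2 vstack_mult_vec matrix_vector_mul_assoc[symmetric]
      by (simp add: vstack_add ZZ_of_def st_def z matrix_vector_mul_assoc Pi)
    finally have state: "Z0 *v \<eta> z = ZZ_of Q x \<xi>" .
    have "((\<chi> i j. 1) :: real ^ ('t::{finite,linorder}) ^ 1) *v \<eta> z
        = (((\<chi> i j. 1) :: real ^ ('t::{finite,linorder}) ^ 1) ** hstack Y1 G2) *v vstack (Pi *v st z) (Q x)"
      by (simp only: matrix_vector_mul_assoc[symmetric] hstack_mult_vec \<eta>_def z fst_conv)
    then have sum0: "(\<Sum>j\<in>UNIV. \<eta> z $ j) = 0"
      unfolding sdp_ones by (simp add: vec_eq_iff matrix_vector_mult_def)
    have ctrl: "K *v ZZ_of Q x \<xi> = U0 *v \<eta> z"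
      unfolding K_def ZZ_of_def matrix_vector_mul_assoc[symmetric] hstack_mult_vec
      by (simp add: \<eta>_def z st_def Pi_def)
    \<comment> \<open>Since \<open>a < b\<close>, derivatives within \<open>{a..b}\<close> are
      unique, also at the end points, so the recorded derivative is the right-hand side of the
      plant.\<close>
    have deriv: "vector_derivative xd (at (ts j) within {a..b})
        = A *v Z_of Q (xd (ts j)) + B *v ud (ts j) + E *v d" for j
    proof -
      have "ts j \<in> {a..b}" using ts_range by blast
      then show ?thesis
        using vector_derivative_within_cbox[of a b "ts j" xd] ab exp_x[of "ts j"]
        by (simp add: f_def)
    qed
    have "Z1 *v \<eta> z = vstack (A *v Z_of Q x + B *v (U0 *v \<eta> z)) (C *v Z_of Q x)"
      using closed_loop_from_data[OF state[unfolded Z0_def] sum0,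
          where A=A and B=B and C=C and E=E and d=d and us="\<lambda>j. ud (ts j)"]
      by (simp add: Z1_def U0_def deriv h_def)
    then show ?thesis
      by (simp add: F_def closed_loop_def z st_def ctrl f_def h_def vstack_add)
  qed
  have dF: "st (F z - F z') = (Z1 ** Y1) *v (Pi *v st (z - z')) + (Z1 ** G2) *v (Q (fst z) - Q (fst z'))"
    for z z'
    by (simp add: st_diff stF \<eta>_def matrix_vector_mult_diff_distrib matrix_vector_right_distrib
        matrix_vector_mul_assoc matrix_mul_assoc)
  have dQ: "norm (Q (fst z) - Q (fst z')) \<le> norm (transpose RR_Q *v st (z - z'))" for z z'
  proof -
    \<comment> \<open>The zero block of \<open>RR_Q\<close> discards the integrator
      component.\<close>
    have "transpose RR_Q *v st (z - z') = transpose R_Q *v (fst z - fst z')"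
      by (simp add: RR_Q_def st_def vec_eq_iff matrix_vector_mult_def transpose_def sum_UNIV_Plus
          del: transpose_matrix_vector)
    then show ?thesis
      using jacobian_bound_imp_norm_diff_le[OF diffQ R_Q, of "fst z" "fst z'"] by simp
  qed
  have lmi: "sym_block3 (Z1 ** Y1 + transpose (Z1 ** Y1) + \<alpha> *\<^sub>R mat 1) (transpose (Z1 ** G2)) (- mat 1)
      (transpose RR_Q ** P) 0 (- mat 1) \<preceq>\<^sub>L 0"
    using sdp_lmi by (simp add: matrix_transpose_mul)
  obtain MP where MP: "0 < MP" "\<And>v. norm (P *v v) \<le> norm v * MP"
    using bounded_linear.pos_bounded[OF matrix_vector_mul_bounded_linear] by metis
  \<comment> \<open>With \<open>u = Pi *v st (z - z')\<close>, the norm of \<open>z - z'\<close> is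
    at most \<open>MP * norm u\<close>; this converts the decay \<open>\<alpha> / 2\<close> in
    \<open>u\<close> into a decay in \<open>z - z'\<close>.\<close>
  define c where "c = \<alpha> / (2 * MP\<^sup>2)"
  have c: "0 < c" using alpha_pos MP by (simp add: c_def)
  have contr: "S (z - z') \<bullet> (F z - F z') \<le> - c * (norm (z - z'))\<^sup>2" for z z'
  proof -
    define u where "u = Pi *v st (z - z')"
    define q where "q = Q (fst z) - Q (fst z')"
    have Pu: "P *v u = st (z - z')" by (simp add: u_def matrix_vector_mul_assoc Pi)
    \<comment> \<open>The Jacobian bound makes the right-hand side of
      \<open>lmi_imp_contraction\<close> nonpositive.\<close>
    have "(norm q)\<^sup>2 \<le> (norm (transpose RR_Q *v (P *v u)))\<^sup>2"
      unfolding Pu q_def by (intro power_mono dQ norm_ge_zero)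
    then have "2 * (u \<bullet> ((Z1 ** Y1) *v u + (Z1 ** G2) *v q)) \<le> - \<alpha> * (norm u)\<^sup>2"
      using lmi_imp_contraction[OF lmi, of u q] by linarith
    then have "2 * (S (z - z') \<bullet> (F z - F z')) \<le> - \<alpha> * (norm u)\<^sup>2"
      by (simp add: inner_st st_S dF u_def q_def)
    moreover have "(norm (z - z'))\<^sup>2 \<le> (norm u)\<^sup>2 * MP\<^sup>2"
      using MP(2)[of u] by (metis Pu norm_st norm_ge_zero power_mono power_mult_distrib)
    then have "c * (norm (z - z'))\<^sup>2 \<le> \<alpha> / 2 * (norm u)\<^sup>2"
      using alpha_pos MP by (simp add: c_def field_simps)
    ultimately show ?thesis by simp
  qed
  \<comment> \<open>The linear part is bounded by \<open>L1\<close>; by \<open>dQ\<close> the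
    nonlinear part is globally Lipschitz too, through \<open>RR_Q\<close> with \<open>L3\<close> and
    then \<open>Z1 ** G2\<close> with \<open>L2\<close>.\<close>
  have lip: "\<exists>L. L-lipschitz_on UNIV F"
  proof -
    obtain L1 where L1: "0 < L1" "\<And>v. norm ((Z1 ** Y1 ** Pi) *v v) \<le> norm v * L1"
      using bounded_linear.pos_bounded[OF matrix_vector_mul_bounded_linear] by metis
    obtain L2 where L2: "0 < L2" "\<And>v. norm ((Z1 ** G2) *v v) \<le> norm v * L2"
      using bounded_linear.pos_bounded[OF matrix_vector_mul_bounded_linear] by metis
    obtain L3 where L3: "0 < L3" "\<And>v. norm (transpose RR_Q *v v) \<le> norm v * L3"
      using bounded_linear.pos_bounded[OF matrix_vector_mul_bounded_linear] by metis
    have "dist (F z) (F z') \<le> (L1 + L3 * L2) * dist z z'" for z z'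
    proof -
      have "dist (F z) (F z') = norm (st (F z - F z'))" by (simp add: norm_st dist_norm)
      also have "\<dots> \<le> norm ((Z1 ** Y1 ** Pi) *v st (z - z')) + norm ((Z1 ** G2) *v (Q (fst z) - Q (fst z')))"
        unfolding dF by (simp add: matrix_vector_mul_assoc norm_triangle_ineq)
      also have "\<dots> \<le> norm (z - z') * L1 + norm (z - z') * L3 * L2"
      proof (rule add_mono)
        show "norm ((Z1 ** Y1 ** Pi) *v st (z - z')) \<le> norm (z - z') * L1"
          using L1(2)[of "st (z - z')"] by (simp add: norm_st)
        have "norm (Q (fst z) - Q (fst z')) \<le> norm (z - z') * L3"
          using dQ[of z z'] L3(2)[of "st (z - z')"] by (simp add: norm_st)
        then show "norm ((Z1 ** G2) *v (Q (fst z) - Q (fst z'))) \<le> norm (z - z') * L3 * L2"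
          using L2 by (meson order_trans mult_right_mono less_imp_le)
      qed
      finally show ?thesis by (simp add: dist_norm algebra_simps)
    qed
    then show ?thesis using L1 L2 L3 by (metis lipschitz_onI add_nonneg_nonneg mult_nonneg_nonneg less_imp_le)
  qed
  then obtain L where lip: "L-lipschitz_on UNIV F" by auto
  have linS: "linear S"
    by (rule linearI)
       (simp_all add: S_def st_def vec_eq_iff matrix_vector_right_distrib matrix_vector_mult_scaleR
          flip: vstack_add vstack_scale)
  have symS: "S z \<bullet> z' = z \<bullet> S z'" for z z'
    unfolding inner_st st_S using inner_transpose_mult[of "st z" Pi "st z'"] by (simp only: Pi)
  have posS: "0 < z \<bullet> S z" if "z \<noteq> 0" for z
    unfolding inner_st st_S using that by (intro Pi) (simp add: st_eq_0)
  obtain e where e: "F e = 0" and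
    conv: "\<And>J z. maximal_solution F J z \<Longrightarrow> J = {0..} \<and> bounded (z ` {0..}) \<and> (z \<longlongrightarrow> e) at_top"
    using contracting_global_convergence[OF linS symS posS c contr lip] by metis
  show ?thesis
    unfolding F_def[symmetric]
  proof (intro conjI allI impI)
    fix x0 \<xi>0
    obtain z where "z 0 = (x0, \<xi>0)" "solves_on F {0..} z"
      using lipschitz_global_solution[OF lip] by metis
    then show "\<exists>x \<xi>. x 0 = x0 \<and> \<xi> 0 = \<xi>0 \<and> solves_on F {0..} (\<lambda>t. (x t, \<xi> t))"
      by (intro exI[of _ "fst \<circ> z"] exI[of _ "snd \<circ> z"]) simp
  next
    fix J x \<xi> assume max: "maximal_solution F J (\<lambda>t. (x t, \<xi> t))"
    show "J = {0..}" using conv[OF max] by simp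
    have bd: "bounded ((\<lambda>t. (x t, \<xi> t)) ` {0..})" and lim: "((\<lambda>t. (x t, \<xi> t)) \<longlongrightarrow> e) at_top"
      using conv[OF max] by auto
    show "bounded (x ` {0..})" "bounded (\<xi> ` {0..})"
      using bounded_fst[OF bd] bounded_snd[OF bd] by (simp_all add: image_image)
    have "isCont h (fst e)"
      unfolding h_def
      by (rule bounded_linear.isCont[OF matrix_vector_mul_bounded_linear])
        (rule differentiable_imp_continuous_within[OF diffZ])
    moreover have "(x \<longlongrightarrow> fst e) at_top" using tendsto_fst[OF lim] by simp
    ultimately have "((\<lambda>t. h (x t) - r) \<longlongrightarrow> h (fst e) - r) at_top"
      by (intro tendsto_diff[OF isCont_tendsto_compose tendsto_const])
    \<comment> \<open>Here \<open>e\<close> is the equilibrium, not the tracking error; the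
      integrator component of \<open>F e = 0\<close> is the required identity.\<close>
    moreover have "h (fst e) - r = 0"
      using e by (cases e; simp add: F_def closed_loop_def zero_prod_def)
    ultimately show "((\<lambda>t. h (x t) - r) \<longlongrightarrow> 0) at_top" by simp
  qed
qed

end
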